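(* Let $H$ be a real Hilbert space, $I=\{1,\dots,m\}$, and for each $i\in I$ let $T_i:H\to H$ be an $\alpha_i$-relaxed cutter with $\alpha_i\in(0,2)$, such that $\bigcap_{i\in I}\operatorname{Fix}T_i\neq\emptyset$. Let $I^t=(i^t_1,\dots,i^t_{m_t})$, $t=1,\dots,E$, be strings with $\bigcup_{t=1}^E I^t=I$, let $\omega_t>0$ with $\sum_{t=1}^E\omega_t=1$, and let $U_t=T_{i^t_{m_t}}\cdots T_{i^t_1}$ and $T=\sum_{t=1}^E\omega_tU_t$. Let $\sigma=\sigma_{\max}$ be the step size function defined in the context, let $\varepsilon\in(0,1)$ and $\lambda\in[\varepsilon,2-\varepsilon]$. Let $\Omega\subseteq H$ be a closed convex set with $\Omega\cap\operatorname{Fix}T\neq\emptyset$, and let $P_\Omega$ denote the orthogonal projection onto $\Omega$. For arbitrary $x^0\in H$ define $$x^{k+1}=P_\Omega\big(x^k+\lambda\sigma(x^k)\,(T(x^k)-x^k)\big),\qquad k\ge0.$$ Then the sequence $\{x^k\}$ converges weakly to a point in $\operatorname{Fix}T\cap\Omega$ if one of the following conditions is satisfied: (i) $T-\mathrm{Id}$ is demi-closed at $0$; or (ii) $U_t-\mathrm{Id}$ is demi-closed at $0$ for all $t=1,\dots,E$; or (iii) $T_i-\mathrm{Id}$ is demi-closed at $0$ for all $i=1,\dots,m$.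
   Context: $\operatorname{Fix}T=\{x\in H: T(x)=x\}$ and $\mathrm{Id}$ is the identity on $H$. For $\alpha\in[0,2]$, an operator $T:H\to H$ with $\operatorname{Fix}T\neq\emptyset$ is an $\alpha$-relaxed cutter if $\alpha\langle T(x)-x,z-x\rangle\ge\|T(x)-x\|^2$ for all $x\in H$ and all $z\in\operatorname{Fix}T$. An operator $F:H\to H$ is demi-closed at $0$ if, for every sequence $x^k$ converging weakly to some $y\in H$ with $F(x^k)\to0$ in norm, one has $F(y)=0$. A string $I^t=(i^t_1,\dots,i^t_{m_t})$ is an ordered subset of $I=\{1,\dots,m\}$. Put $S^t_0=\mathrm{Id}$, $S^t_j=T_{i^t_j}\cdots T_{i^t_1}$ and $\zeta^t_j(x)=S^t_j(x)-S^t_{j-1}(x)$. The step size function $\sigma_{\max}:H\to(0,\infty)$ is $$\sigma_{\max}(x)=\frac{\sum_{t=1}^E\omega_t\sum_{j=1}^{m_t}\big\langle U_t(x)-S^t_j(x)+\frac{1}{\alpha_{i^t_j}}\zeta^t_j(x),\ \zeta^t_j(x)\big\rangle}{\|T(x)-x\|^2}\ \text{ for }x\in H\setminus\operatorname{Fix}T,$$ and $\sigma_{\max}(x)=1$ for $x\in\operatorname{Fix}T$. *)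

theory Defs
  imports "HOL-Analysis.Analysis"
begin

text \<open>A real Hilbert space is a type of sort \<open>{real_inner, complete_space}\<close>.\<close>

definition Fix :: "('a \<Rightarrow> 'a) \<Rightarrow> 'a set" where
  "Fix T = {x. T x = x}"

definition relaxed_cutter :: "real \<Rightarrow> ('a::real_inner \<Rightarrow> 'a) \<Rightarrow> bool" where
  "relaxed_cutter \<alpha> T \<longleftrightarrow>
     \<alpha> \<in> {0..2} \<and> Fix T \<noteq> {} \<and>
     (\<forall>x. \<forall>z \<in> Fix T. \<alpha> * inner (T x - x) (z - x) \<ge> (norm (T x - x))\<^sup>2)"

definition weakly_converges :: "(nat \<Rightarrow> 'a::real_inner) \<Rightarrow> 'a \<Rightarrow> bool" where
  "weakly_converges x y \<longleftrightarrow> (\<forall>z. (\<lambda>k. inner (x k) z) \<longlonglongrightarrow> inner y z)"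

definition demiclosed_at_0 :: "('a::real_inner \<Rightarrow> 'a) \<Rightarrow> bool" where
  "demiclosed_at_0 F \<longleftrightarrow>
     (\<forall>x y. weakly_converges x y \<longrightarrow> (\<lambda>k. F (x k)) \<longlonglongrightarrow> 0 \<longrightarrow> F y = 0)"

text \<open>The library's \<^const>\<open>closest_point\<close> is restricted to Heine-Borel spaces. The
  description below denotes a unique point if \<open>\<Omega>\<close> is nonempty, closed and convex.\<close>

definition proj :: "'a::real_inner set \<Rightarrow> 'a \<Rightarrow> 'a" where
  "proj \<Omega> x = (THE p. p \<in> \<Omega> \<and> (\<forall>y \<in> \<Omega>. dist x p \<le> dist x y))"

text \<open>A string \<open>(i\<^sub>1, \<dots>, i\<^sub>n)\<close> is a list \<open>s\<close>, with \<open>i\<^sub>j = s ! (j - 1)\<close>; then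
  \<open>string_comp T s j\<close> is \<open>S\<^sub>j = T\<^bsub>i\<^sub>j\<^esub> \<circ> \<cdots> \<circ> T\<^bsub>i\<^sub>1\<^esub>\<close>, for \<open>j \<le> length s\<close>.\<close>

primrec string_comp :: "(nat \<Rightarrow> 'a \<Rightarrow> 'a) \<Rightarrow> nat list \<Rightarrow> nat \<Rightarrow> 'a \<Rightarrow> 'a" where
  "string_comp T s 0 = id"
| "string_comp T s (Suc j) = T (s ! j) \<circ> string_comp T s j"

definition string_op :: "(nat \<Rightarrow> 'a \<Rightarrow> 'a) \<Rightarrow> nat list \<Rightarrow> 'a \<Rightarrow> 'a" where
  "string_op T s = string_comp T s (length s)"

definition string_diff ::
    "(nat \<Rightarrow> 'a::real_inner \<Rightarrow> 'a) \<Rightarrow> nat list \<Rightarrow> nat \<Rightarrow> 'a \<Rightarrow> 'a" where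
  "string_diff T s j x = string_comp T s j x - string_comp T s (j - 1) x"

definition string_average ::
    "(nat \<Rightarrow> 'a::real_inner \<Rightarrow> 'a) \<Rightarrow> nat \<Rightarrow> (nat \<Rightarrow> nat list) \<Rightarrow> (nat \<Rightarrow> real) \<Rightarrow> 'a \<Rightarrow> 'a" where
  "string_average T E s \<omega> x = (\<Sum>t=1..E. \<omega> t *\<^sub>R string_op T (s t) x)"

definition sigma_max ::
    "(nat \<Rightarrow> 'a::real_inner \<Rightarrow> 'a) \<Rightarrow> (nat \<Rightarrow> real) \<Rightarrow> nat \<Rightarrow> (nat \<Rightarrow> nat list) \<Rightarrow> (nat \<Rightarrow> real)
      \<Rightarrow> 'a \<Rightarrow> real" where
  "sigma_max T \<alpha> E s \<omega> x =
     (if x \<in> Fix (string_average T E s \<omega>) then 1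
      else (\<Sum>t=1..E. \<omega> t * (\<Sum>j=1..length (s t).
              inner (string_op T (s t) x - string_comp T (s t) j x
                       + (1 / \<alpha> (s t ! (j - 1))) *\<^sub>R string_diff T (s t) j x)
                    (string_diff T (s t) j x)))
           / (norm (string_average T E s \<omega> x - x))\<^sup>2)"

end

theory Submission
  imports Defs
begin

text \<open>The numerator \<open>g(x)\<close> of \<open>\<sigma>\<^sub>m\<^sub>a\<^sub>x\<close> telescopes to a weighted sum of the nonnegative terms
  \<open>\<parallel>U\<^sub>t x - x\<parallel>\<^sup>2 / 2\<close> and \<open>(1/\<alpha>\<^sub>i - 1/2) \<parallel>\<zeta>\<^sub>j\<parallel>\<^sup>2\<close>, and the cutter inequalities give
  \<open>g(x) \<le> \<langle>T x - x, z - x\<rangle>\<close> for every common fixed point \<open>z\<close>. Hence \<open>Fix T = \<Inter>\<^sub>i Fix T\<^sub>i\<close>,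
  \<open>\<sigma> \<ge> 1/2\<close>, and the iteration is Fejer monotone with
  \<open>\<parallel>x\<^sub>k\<^sub>+\<^sub>1 - z\<parallel>\<^sup>2 \<le> \<parallel>x\<^sub>k - z\<parallel>\<^sup>2 - \<lambda>(2 - \<lambda>) \<sigma>(x\<^sub>k)\<^sup>2 \<parallel>T x\<^sub>k - x\<^sub>k\<parallel>\<^sup>2\<close>. So
  \<open>\<sigma>(x\<^sub>k) \<parallel>T x\<^sub>k - x\<^sub>k\<parallel> \<rightarrow> 0\<close> and thus \<open>g(x\<^sub>k) = \<sigma>(x\<^sub>k) \<parallel>T x\<^sub>k - x\<^sub>k\<parallel>\<^sup>2 \<rightarrow> 0\<close>, which drives all the
  increments \<open>\<zeta>\<^sub>j(x\<^sub>k)\<close> to \<open>0\<close>. Each demi-closedness hypothesis then puts the weak cluster points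
  into \<open>Fix T \<inter> \<Omega>\<close>, and Opial's argument applies.\<close>

section \<open>Projections and weak compactness in Hilbert space\<close>

text \<open>Parallelogram law: the midpoint of \<open>a\<close> and \<open>b\<close> lies in
  \<open>K\<close>, so its norm is at least \<open>d\<close>. Two points of nearly minimal norm are
  therefore close to each other.\<close>

lemma norm_diff_power2_le_midpoint:
  fixes a b :: "'a::real_inner"
  assumes "convex K" "a \<in> K" "b \<in> K" "\<And>y. y \<in> K \<Longrightarrow> d \<le> norm y" "0 \<le> d"
  shows "(norm (a - b))\<^sup>2 \<le> 2 * (norm a)\<^sup>2 + 2 * (norm b)\<^sup>2 - 4 * d\<^sup>2"
proof -
  have "(1/2) *\<^sub>R a + (1/2) *\<^sub>R b \<in> K"
    using assms(1-3) by (intro convexD) auto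
  then have "d\<^sup>2 \<le> (norm ((1/2) *\<^sub>R a + (1/2) *\<^sub>R b))\<^sup>2"
    using assms(4,5) by (intro power_mono) auto
  also have "\<dots> = ((norm a)\<^sup>2 + (norm b)\<^sup>2 + 2 * inner a b) / 4"
    unfolding power2_norm_eq_inner
    by (simp add: inner_add inner_commute algebra_simps)
  finally show ?thesis
    unfolding power2_norm_eq_inner by (simp add: inner_diff inner_commute algebra_simps)
qed

text \<open>The squared distances \<open>f n\<close> from the origin to \<open>K n\<close> increase
  and are bounded, hence converge. Points \<open>p n\<close> of \<open>K n\<close> with nearly
  minimal norm are then Cauchy by the midpoint estimate, and their limit lies in every
  \<open>K n\<close>. Both the existence of projections and that of weak limits are reduced to this
  fact.\<close>

lemma decreasing_closed_convex_Inter_nonempty: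
  fixes K :: "nat \<Rightarrow> 'a::{real_inner,complete_space} set"
  assumes cl: "\<And>n. closed (K n)" and cv: "\<And>n. convex (K n)" and dec: "decseq K"
    and bd: "\<And>n. \<exists>x\<in>K n. norm x \<le> B"
  shows "(\<Inter>n. K n) \<noteq> {}"
proof -
  define f where "f n = (infdist 0 (K n))\<^sup>2" for n
  have ne: "K n \<noteq> {}" for n using bd by auto
  have f_le: "f n \<le> B\<^sup>2" for n
    unfolding f_def using bd[of n] infdist_le2[of _ "K n" 0 B] infdist_nonneg[of 0 "K n"]
    by (auto intro!: power_mono)
  have mono_f: "incseq f"
    unfolding f_def incseq_def using dec ne infdist_nonneg
    by (auto intro!: power_mono infdist_mono simp: decseq_def)
  have "\<exists>p\<in>K n. (norm p)\<^sup>2 < f n + inverse (real (Suc n))" for n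
  proof -
    have "infdist 0 (K n) < sqrt (f n + inverse (real (Suc n)))"
      by (rule real_less_rsqrt) (simp add: f_def)
    moreover have "bdd_below (dist 0 ` K n)" by (rule bdd_belowI[of _ 0]) auto
    ultimately obtain p where p: "p \<in> K n" "dist 0 p < sqrt (f n + inverse (real (Suc n)))"
      using ne[of n] by (auto simp: infdist_notempty cINF_less_iff)
    have "(norm p)\<^sup>2 < (sqrt (f n + inverse (real (Suc n))))\<^sup>2"
      using p(2) by (intro power_strict_mono) auto
    then show ?thesis using p(1) by (auto simp: f_def)
  qed
  then obtain p where p: "\<And>n. p n \<in> K n" "\<And>n. (norm (p n))\<^sup>2 < f n + inverse (real (Suc n))"
    by metis
  \<comment> \<open>Since \<open>K\<close> decreases, \<open>p i\<close> also lies in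
    \<open>K n\<close>, so the midpoint estimate applies inside \<open>K n\<close> with
    \<open>d = infdist 0 (K n)\<close>.\<close>
  have step: "(dist (p i) (p n))\<^sup>2 \<le> 2 * (f i - f n) + 4 * inverse (real (Suc n))" if "n \<le> i" for i n
  proof -
    have "p i \<in> K n" using p(1)[of i] dec that by (auto simp: decseq_def)
    then have "(dist (p i) (p n))\<^sup>2 \<le> 2 * (norm (p i))\<^sup>2 + 2 * (norm (p n))\<^sup>2 - 4 * f n"
      unfolding dist_norm f_def
    proof (rule norm_diff_power2_le_midpoint[OF cv _ p(1) _ infdist_nonneg])
      show "infdist 0 (K n) \<le> norm y" if "y \<in> K n" for y
        using infdist_le[OF that, of 0] by simp
    qed
    moreover have "inverse (real (Suc i)) \<le> inverse (real (Suc n))" using that by (simp add: field_simps)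
    ultimately show ?thesis using p(2)[of i] p(2)[of n] by argo
  qed
  obtain L where L: "f \<longlonglongrightarrow> L" using mono_f f_le incseq_convergent by blast
  have fL: "f i \<le> L" for i using incseq_le[OF mono_f L] .
  have "Cauchy p"
  proof (rule metric_CauchyI)
    fix e :: real assume "e > 0"
    have "(\<lambda>n. 2 * (L - f n) + 4 * inverse (real (Suc n))) \<longlonglongrightarrow> 2 * (L - L) + 4 * 0"
      by (intro tendsto_intros L LIMSEQ_inverse_real_of_nat)
    then have "\<forall>\<^sub>F n in sequentially. 2 * (L - f n) + 4 * inverse (real (Suc n)) < (e/2)\<^sup>2"
      by (rule order_tendstoD(2)) (use \<open>e > 0\<close> in simp)
    then obtain n where n: "2 * (L - f n) + 4 * inverse (real (Suc n)) < (e/2)\<^sup>2"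
      by (auto simp: eventually_sequentially)
    have "dist (p i) (p n) < e/2" if "i \<ge> n" for i
    proof -
      have "(dist (p i) (p n))\<^sup>2 < (e/2)\<^sup>2"
        using step[OF that] n fL[of i] by argo
      then show ?thesis using \<open>e > 0\<close> power_less_imp_less_base by fastforce
    qed
    then show "\<exists>M. \<forall>i\<ge>M. \<forall>j\<ge>M. dist (p i) (p j) < e"
      using dist_triangle_half_r[of "p n"] by (intro exI[of _ n]) (simp add: dist_commute)
  qed
  then obtain q where q: "p \<longlonglongrightarrow> q" using Cauchy_convergent convergentD by blast
  have "q \<in> K n" for n
  proof (rule Lim_in_closed_set[OF cl _ _ q])
    show "\<forall>\<^sub>F i in sequentially. p i \<in> K n"
      unfolding eventually_sequentially using p(1) decseqD[OF dec] by blast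
  qed simp
  then show ?thesis by auto
qed

text \<open>The balls around \<open>x\<close> with radii decreasing to \<open>infdist x K\<close>
  cut \<open>K\<close> in a decreasing sequence of nonempty closed convex sets. A common point of
  these sets attains the distance.\<close>

lemma closest_point_exists_Hilbert:
  fixes K :: "'a::{real_inner,complete_space} set"
  assumes "closed K" "convex K" "K \<noteq> {}"
  shows "\<exists>p\<in>K. \<forall>y\<in>K. dist x p \<le> dist x y"
proof -
  define C where "C n = K \<inter> cball x (infdist x K + 1 / real (Suc n))" for n
  have "(\<Inter>n. C n) \<noteq> {}"
  proof (rule decreasing_closed_convex_Inter_nonempty)
    show "closed (C n)" "convex (C n)" for n
      using assms by (auto simp: C_def intro: convex_Int)
    have "1 / real (Suc n) \<le> 1 / real (Suc k)" if "k \<le> n" for k n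
      using that by (simp add: field_simps)
    then show "decseq C"
      unfolding C_def decseq_def by (intro allI impI Int_mono subset_refl subset_cball add_left_mono)
    show "\<exists>y\<in>C n. norm y \<le> norm x + infdist x K + 1" for n
    proof -
      have "bdd_below (dist x ` K)" by (rule bdd_belowI[of _ 0]) auto
      moreover have "infdist x K < infdist x K + 1 / real (Suc n)" by simp
      ultimately obtain y where y: "y \<in> K" "dist x y < infdist x K + 1 / real (Suc n)"
        using assms(3) cINF_less_iff[of K "dist x"] unfolding infdist_notempty[OF assms(3)] by blast
      have "norm y \<le> norm x + dist x y" by (metis dist_norm norm_triangle_sub norm_minus_commute)
      moreover have "1 / real (Suc n) \<le> 1" by simp
      ultimately have "norm y \<le> norm x + infdist x K + 1" using y(2) by linarith
      then show ?thesis using y by (intro bexI[of _ y]) (auto simp: C_def)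
    qed
  qed
  then obtain p where p: "\<And>n. p \<in> C n" by auto
  have "dist x p \<le> infdist x K"
  proof (rule LIMSEQ_le_const)
    show "(\<lambda>n. infdist x K + inverse (real (Suc n))) \<longlonglongrightarrow> infdist x K"
      using tendsto_add[OF tendsto_const LIMSEQ_inverse_real_of_nat, of "infdist x K"] by simp
    show "\<exists>N. \<forall>n\<ge>N. dist x p \<le> infdist x K + inverse (real (Suc n))"
      using p by (auto simp: C_def inverse_eq_divide)
  qed
  then show ?thesis
    using p infdist_le[of _ K x] by (intro bexI[of _ p]) (force simp: C_def)+
qed

lemma
  fixes \<Omega> :: "'a::{real_inner,complete_space} set"
  assumes "closed \<Omega>" "convex \<Omega>" "\<Omega> \<noteq> {}"
  shows proj_in: "proj \<Omega> x \<in> \<Omega>"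
    and proj_inner_le: "y \<in> \<Omega> \<Longrightarrow> inner (x - proj \<Omega> x) (y - proj \<Omega> x) \<le> 0"
proof -
  have "\<exists>!p. p \<in> \<Omega> \<and> (\<forall>y\<in>\<Omega>. dist x p \<le> dist x y)"
    using closest_point_exists_Hilbert[OF assms, of x] any_closest_point_unique[OF assms(2,1), of _ _ x]
    by metis
  from theI'[OF this] have *: "proj \<Omega> x \<in> \<Omega>" "\<forall>y\<in>\<Omega>. dist x (proj \<Omega> x) \<le> dist x y"
    unfolding proj_def by auto
  show "proj \<Omega> x \<in> \<Omega>" by fact
  show "inner (x - proj \<Omega> x) (y - proj \<Omega> x) \<le> 0" if "y \<in> \<Omega>"
    using any_closest_point_dot[OF assms(2,1) *(1) that *(2)] .
qed

text \<open>Expand the square of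
  \<open>x - z = (x - proj \<Omega> x) + (proj \<Omega> x - z)\<close>; the obtuse angle at the
  projection gives the cross term the right sign.\<close>

lemma proj_dist_le:
  fixes \<Omega> :: "'a::{real_inner,complete_space} set"
  assumes "closed \<Omega>" "convex \<Omega>" "z \<in> \<Omega>"
  shows "norm (proj \<Omega> x - z) \<le> norm (x - z)"
proof (rule power2_le_imp_le)
  have "inner (x - proj \<Omega> x) (z - proj \<Omega> x) \<le> 0"
    using assms by (intro proj_inner_le) auto
  moreover have "(norm (x - z))\<^sup>2 = (norm (proj \<Omega> x - z))\<^sup>2 + (norm (x - proj \<Omega> x))\<^sup>2
      - 2 * inner (x - proj \<Omega> x) (z - proj \<Omega> x)"
    unfolding power2_norm_eq_inner by (simp add: inner_diff inner_commute)
  ultimately show "(norm (proj \<Omega> x - z))\<^sup>2 \<le> (norm (x - z))\<^sup>2"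
    using zero_le_power2[of "norm (x - proj \<Omega> x)"] by linarith
qed simp

text \<open>In a subspace the variational inequality may be tested at both
  \<open>proj W v + w\<close> and \<open>proj W v - w\<close>, which turns it into an
  equality.\<close>

lemma closed_subspace_orthogonal_decomposition:
  fixes W :: "'a::{real_inner,complete_space} set"
  assumes "closed W" "subspace W"
  obtains p where "p \<in> W" "\<And>w. w \<in> W \<Longrightarrow> inner w (v - p) = 0"
proof
  have *: "closed W" "convex W" "W \<noteq> {}"
    using assms subspace_0 subspace_imp_convex by auto
  show pW: "proj W v \<in> W" by (rule proj_in[OF *])
  fix w assume w: "w \<in> W"
  have "inner (v - proj W v) (proj W v + w - proj W v) \<le> 0"
    "inner (v - proj W v) (proj W v - w - proj W v) \<le> 0"
    by (intro proj_inner_le[OF *] subspace_add subspace_diff assms w pW)+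
  then show "inner w (v - proj W v) = 0"
    by (simp add: inner_commute)
qed

text \<open>The functional \<open>inner _ (y - ?p)\<close>, with \<open>?p\<close> the projection of
  \<open>y\<close>, is at most \<open>inner ?p (y - ?p)\<close> on \<open>K\<close>. In the weak
  limit this bound becomes \<open>inner (y - ?p) (y - ?p) \<le> 0\<close>.\<close>

lemma weakly_converges_in_closed_convex:
  fixes K :: "'a::{real_inner,complete_space} set"
  assumes "closed K" "convex K" "weakly_converges x y" "\<forall>\<^sub>F k in sequentially. x k \<in> K"
  shows "y \<in> K"
proof -
  have K: "closed K" "convex K" "K \<noteq> {}"
    using assms eventually_happens[OF assms(4)] by auto
  let ?p = "proj K y"
  have "(\<lambda>k. inner (x k) (y - ?p) - inner ?p (y - ?p)) \<longlonglongrightarrow> inner y (y - ?p) - inner ?p (y - ?p)"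
    using assms(3) by (intro tendsto_diff tendsto_const) (auto simp: weakly_converges_def)
  moreover have "\<forall>\<^sub>F k in sequentially. inner (x k) (y - ?p) - inner ?p (y - ?p) \<le> 0"
    using assms(4)
  proof eventually_elim
    case (elim k)
    then show ?case using proj_inner_le[OF K, of "x k" y] by (simp add: inner_diff inner_commute)
  qed
  ultimately have "inner y (y - ?p) - inner ?p (y - ?p) \<le> 0"
    by (intro tendsto_upperbound) auto
  then have "inner (y - ?p) (y - ?p) \<le> 0" by (simp only: inner_diff_left)
  then have "y = ?p" by (metis inner_ge_zero inner_eq_zero_iff order_antisym right_minus_eq)
  then show ?thesis using proj_in[OF K] by metis
qed

text \<open>Tychonoff's theorem takes the place of a diagonal argument: the rows of \<open>a\<close>
  lie in a countable product of compact intervals, which is sequentially compact, and convergence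
  there is coordinatewise.\<close>

lemma bounded_family_convergent_subseq:
  fixes a :: "nat \<Rightarrow> nat \<Rightarrow> real"
  assumes "\<And>k i. \<bar>a k i\<bar> \<le> B i"
  obtains r :: "nat \<Rightarrow> nat" where "strict_mono r" "\<And>i. convergent (\<lambda>k. a (r k) i)"
proof -
  let ?S = "PiE UNIV (\<lambda>i. {- B i..B i})"
  have "compactin (product_topology (\<lambda>i. euclidean) UNIV) ?S"
    unfolding compactin_PiE by auto
  then have "compact ?S"
    by (simp add: euclidean_product_topology)
  then have "seq_compact ?S" by (rule compact_imp_seq_compact)
  moreover have "a k \<in> ?S" for k using assms by (auto simp: abs_le_iff minus_le_iff)
  ultimately obtain l r where r: "strict_mono r" "(a \<circ> r) \<longlonglongrightarrow> l"
    unfolding seq_compact_def by metis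
  have "(\<lambda>k. a (r k) i) \<longlonglongrightarrow> l i" for i
    using continuous_on_tendsto_compose[OF continuous_on_product_coordinates[of i] r(2)]
    by (simp add: o_def)
  then show ?thesis using that[OF r(1)] unfolding convergent_def by blast
qed

text \<open>No separability is needed: the vectors \<open>v\<close> for which \<open>\<langle>x\<^sub>r\<^sub>k, v\<rangle>\<close> converges form a closed
  subspace containing every \<open>x\<^sub>i\<close>, hence also its own orthogonal complement.\<close>

lemma bounded_subseq_inner_convergent:
  fixes x :: "nat \<Rightarrow> 'a::{real_inner,complete_space}"
  assumes bd: "\<And>k. norm (x k) \<le> B"
  obtains r :: "nat \<Rightarrow> nat" where "strict_mono r" "\<And>v. convergent (\<lambda>k. inner (x (r k)) v)"
proof -
  have B0: "0 \<le> B" using norm_ge_zero bd order_trans by blast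
  have "\<bar>inner (x k) (x i)\<bar> \<le> B * B" for k i
    by (rule order_trans[OF Cauchy_Schwarz_ineq2]) (intro mult_mono bd B0 norm_ge_zero)
  then obtain r :: "nat \<Rightarrow> nat" where
    r: "strict_mono r" "\<And>i. convergent (\<lambda>k. inner (x (r k)) (x i))"
    using bounded_family_convergent_subseq[of "\<lambda>k i. inner (x k) (x i)" "\<lambda>_. B * B"] by blast
  define W where "W = {v. convergent (\<lambda>k. inner (x (r k)) v)}"
  have "subspace W"
    unfolding W_def subspace_def
    by (auto simp: inner_add_right convergent_const intro: convergent_add convergent_mult[OF convergent_const])
  moreover have "closed W"
    unfolding closed_sequential_limits
  proof (intro allI impI)
    fix v l assume "(\<forall>n. v n \<in> W) \<and> v \<longlonglongrightarrow> l"
    then have v: "\<And>n. v n \<in> W" "v \<longlonglongrightarrow> l" by auto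
    have "Cauchy (\<lambda>k. inner (x (r k)) l)"
    proof (rule metric_CauchyI)
      fix e :: real assume e: "e > 0"
      \<comment> \<open>Chosen so that replacing \<open>l\<close> by \<open>v n\<close> costs less
        than \<open>e/4\<close> at each of two indices, leaving \<open>e/2\<close> for the Cauchy
        property at \<open>v n\<close>. The summand 1 covers \<open>B = 0\<close>.\<close>
      define d where "d = e / (4 * (B + 1))"
      have d: "d > 0" "B * d < e/4" using e B0 by (auto simp: d_def field_simps)
      obtain n where n: "norm (v n - l) < d"
        using LIMSEQ_D[OF v(2) d(1)] by auto
      have near: "\<bar>inner (x (r k)) (v n) - inner (x (r k)) l\<bar> < e/4" for k
      proof -
        have "\<bar>inner (x (r k)) (v n - l)\<bar> \<le> B * d"
          by (rule order_trans[OF Cauchy_Schwarz_ineq2]) (use bd n B0 in \<open>intro mult_mono; auto\<close>)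
        then show ?thesis using d by (simp add: inner_diff_right)
      qed
      have "Cauchy (\<lambda>k. inner (x (r k)) (v n))"
        using v(1)[of n] by (auto simp: W_def intro: convergent_Cauchy)
      then obtain M where M: "\<And>i j. i \<ge> M \<Longrightarrow> j \<ge> M \<Longrightarrow>
          dist (inner (x (r i)) (v n)) (inner (x (r j)) (v n)) < e/2"
        using e by (meson half_gt_zero metric_CauchyD)
      have "dist (inner (x (r i)) l) (inner (x (r j)) l) < e" if "i \<ge> M" "j \<ge> M" for i j
        using M[OF that] near[of i] near[of j] unfolding dist_real_def by linarith
      then show "\<exists>M. \<forall>i\<ge>M. \<forall>j\<ge>M. dist (inner (x (r i)) l) (inner (x (r j)) l) < e" by blast
    qed
    then show "l \<in> W" by (simp add: W_def Cauchy_convergent)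
  qed
  moreover have xW: "x i \<in> W" for i using r(2) by (simp add: W_def)
  ultimately have W: "v \<in> W" for v
  proof -
    obtain p where p: "p \<in> W" "\<And>w. w \<in> W \<Longrightarrow> inner w (v - p) = 0"
      using closed_subspace_orthogonal_decomposition[OF \<open>closed W\<close> \<open>subspace W\<close>] by blast
    have "v - p \<in> W" using p(2)[OF xW] by (simp add: W_def convergent_const)
    then show ?thesis using subspace_add[OF \<open>subspace W\<close> p(1)] by fastforce
  qed
  show ?thesis using that[OF r(1)] W by (simp add: W_def)
qed

text \<open>A point in all the closed convex hulls of the tails represents the limit functional, so
  that the Riesz representation theorem is not needed.\<close>

lemma bounded_weakly_convergent_subseq:
  fixes x :: "nat \<Rightarrow> 'a::{real_inner,complete_space}"
  assumes bd: "\<And>k. norm (x k) \<le> B"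
  obtains r :: "nat \<Rightarrow> nat" and y where "strict_mono r" "weakly_converges (x \<circ> r) y"
proof -
  obtain r :: "nat \<Rightarrow> nat" where r: "strict_mono r" "\<And>v. convergent (\<lambda>k. inner (x (r k)) v)"
    using bounded_subseq_inner_convergent[of x, OF bd] by metis
  define K where "K n = closure (convex hull ((x \<circ> r) ` {n..}))" for n
  have sub: "x (r k) \<in> K n" if "k \<ge> n" for k n
  proof -
    have "x (r k) \<in> (x \<circ> r) ` {n..}" using that by auto
    then show ?thesis unfolding K_def by (meson closure_subset hull_inc subsetD)
  qed
  have "(\<Inter>n. K n) \<noteq> {}"
  proof (rule decreasing_closed_convex_Inter_nonempty)
    show "closed (K n)" "convex (K n)" for n
      by (auto simp: K_def convex_closure)
    show "decseq K"
      unfolding K_def decseq_def by (intro allI impI closure_mono hull_mono) auto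
    show "\<exists>x\<in>K n. norm x \<le> B" for n using sub bd by blast
  qed
  then obtain y where y: "\<And>n. y \<in> K n" by auto
  have le: "inner y v \<le> lim (\<lambda>k. inner (x (r k)) v)" for v
  proof (rule field_le_epsilon)
    fix e :: real assume "e > 0"
    let ?l = "lim (\<lambda>k. inner (x (r k)) v)"
    have "(\<lambda>k. inner (x (r k)) v) \<longlonglongrightarrow> ?l" using r(2) by (simp add: convergent_LIMSEQ_iff)
    then have "\<forall>\<^sub>F k in sequentially. inner (x (r k)) v < ?l + e"
      by (rule order_tendstoD(2)) (use \<open>e > 0\<close> in simp)
    then obtain N where N: "\<And>k. k \<ge> N \<Longrightarrow> inner (x (r k)) v < ?l + e"
      by (auto simp: eventually_sequentially)
    \<comment> \<open>A closed halfspace containing the tail from \<open>N\<close> on also contains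
      the closed convex hull of that tail.\<close>
    have "K N \<subseteq> {w. inner v w \<le> ?l + e}"
      unfolding K_def
      by (intro closure_minimal hull_minimal closed_halfspace_le convex_halfspace_le)
        (use N in \<open>force simp: inner_commute\<close>)
    then show "inner y v \<le> ?l + e" using y[of N] by (auto simp: inner_commute)
  qed
  have "inner y v = lim (\<lambda>k. inner (x (r k)) v)" for v
  proof (rule antisym[OF le])
    \<comment> \<open>The limit is odd in \<open>v\<close>, so the one-sided bound \<open>le\<close>
      at \<open>- v\<close> is the reverse inequality.\<close>
    have "lim (\<lambda>k. inner (x (r k)) (- v)) = - lim (\<lambda>k. inner (x (r k)) v)"
      using r(2)[of v] by (intro limI) (auto simp: convergent_LIMSEQ_iff intro: tendsto_minus)
    then show "lim (\<lambda>k. inner (x (r k)) v) \<le> inner y v" using le[of "- v"] by simp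
  qed
  then have "weakly_converges (x \<circ> r) y"
    using r(2) by (simp add: weakly_converges_def convergent_LIMSEQ_iff o_def)
  then show ?thesis using that r(1) by blast
qed

text \<open>This carries a weak limit over from the iterates to the intermediate points of a string,
  which differ from them by a null sequence.\<close>

lemma weakly_converges_add_null:
  assumes "weakly_converges x y" "d \<longlonglongrightarrow> 0"
  shows "weakly_converges (\<lambda>k. x k + d k) y"
  unfolding weakly_converges_def
proof
  fix z
  have "(\<lambda>k. inner (x k) z + inner (d k) z) \<longlonglongrightarrow> inner y z + inner 0 z"
    using assms(1) tendsto_inner[OF assms(2) tendsto_const]
    by (intro tendsto_add) (simp_all only: weakly_converges_def)
  then show "(\<lambda>k. inner (x k + d k) z) \<longlonglongrightarrow> inner y z" by (simp add: inner_add_left)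
qed

text \<open>Opial's argument: if two cluster points \<open>y\<close> and \<open>y'\<close> lie in \<open>C\<close>, then
  \<open>\<parallel>x\<^sub>k - y\<parallel>\<^sup>2 - \<parallel>x\<^sub>k - y'\<parallel>\<^sup>2\<close> converges, hence so does \<open>\<langle>x\<^sub>k, y - y'\<rangle>\<close>, and comparing its limits
  along the two subsequences gives \<open>\<langle>y, y - y'\<rangle> = \<langle>y', y - y'\<rangle>\<close>.\<close>

lemma Opial_weak_convergence:
  fixes x :: "nat \<Rightarrow> 'a::{real_inner,complete_space}"
  assumes "C \<noteq> {}" and conv: "\<And>z. z \<in> C \<Longrightarrow> convergent (\<lambda>k. norm (x k - z))"
    and cluster: "\<And>r y. strict_mono (r :: nat \<Rightarrow> nat) \<Longrightarrow> weakly_converges (x \<circ> r) y \<Longrightarrow> y \<in> C"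
  shows "\<exists>y\<in>C. weakly_converges x y"
proof -
  obtain z where z: "z \<in> C" using assms(1) by auto
  obtain B where B: "\<And>k. norm (x k - z) \<le> B"
    using convergent_imp_Bseq[OF conv[OF z]] unfolding Bseq_def by auto
  have bd: "norm (x k) \<le> B + norm z" for k
    using B[of k] norm_triangle_sub[of "x k" z] by linarith
  obtain r y where ry: "strict_mono (r :: nat \<Rightarrow> nat)" "weakly_converges (x \<circ> r) y"
    by (rule bounded_weakly_convergent_subseq[of x, OF bd])
  have uniq: "y' = y" if r': "strict_mono (r' :: nat \<Rightarrow> nat)" "weakly_converges (x \<circ> r') y'" for r' y'
  proof -
    have C: "y \<in> C" "y' \<in> C" using cluster ry r' by auto
    obtain a b where ab: "(\<lambda>k. norm (x k - y)) \<longlonglongrightarrow> a" "(\<lambda>k. norm (x k - y')) \<longlonglongrightarrow> b"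
      using conv C unfolding convergent_def by meson
    let ?c = "(b\<^sup>2 - a\<^sup>2 + (norm y)\<^sup>2 - (norm y')\<^sup>2) / 2"
    have "(\<lambda>k. ((norm (x k - y'))\<^sup>2 - (norm (x k - y))\<^sup>2 + (norm y)\<^sup>2 - (norm y')\<^sup>2) / 2) \<longlonglongrightarrow> ?c"
      by (intro tendsto_divide tendsto_diff tendsto_add tendsto_power tendsto_const ab) simp
    moreover have "((norm (w - y'))\<^sup>2 - (norm (w - y))\<^sup>2 + (norm y)\<^sup>2 - (norm y')\<^sup>2) / 2 = inner w (y - y')" for w
      unfolding power2_norm_eq_inner by (simp add: inner_diff inner_commute)
    ultimately have lim: "(\<lambda>k. inner (x k) (y - y')) \<longlonglongrightarrow> ?c" by simp
    have "inner y (y - y') = ?c"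
      using LIMSEQ_unique[OF _ LIMSEQ_subseq_LIMSEQ[OF lim ry(1)]] ry(2)
      unfolding weakly_converges_def o_def by simp
    moreover have "inner y' (y - y') = ?c"
      using LIMSEQ_unique[OF _ LIMSEQ_subseq_LIMSEQ[OF lim r'(1)]] r'(2)
      unfolding weakly_converges_def o_def by simp
    ultimately have "inner (y - y') (y - y') = 0" by (simp add: inner_diff_left)
    then show ?thesis by simp
  qed
  have "weakly_converges x y"
  proof (rule ccontr)
    assume "\<not> weakly_converges x y"
    then obtain v where "\<not> (\<lambda>k. inner (x k) v) \<longlonglongrightarrow> inner y v"
      unfolding weakly_converges_def by blast
    then obtain e where e: "e > 0" "\<not> (\<forall>\<^sub>F k in sequentially. dist (inner (x k) v) (inner y v) < e)"
      unfolding tendsto_iff by blast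
    \<comment> \<open>Along infinitely many indices the inner products stay \<open>e\<close> away
      from the limit. These indices still contain a weakly convergent subsequence, whose limit must
      be \<open>y\<close> by \<open>uniq\<close>: a contradiction.\<close>
    let ?A = "{k. \<not> dist (inner (x k) v) (inner y v) < e}"
    have "infinite ?A"
      using e(2) unfolding not_eventually frequently_cofinite[symmetric] cofinite_eq_sequentially .
    then obtain q :: "nat \<Rightarrow> nat" where q: "strict_mono q" "\<And>n. q n \<in> ?A"
      by (metis infinite_enumerate)
    have "norm ((x \<circ> q) k) \<le> B + norm z" for k using bd by simp
    then obtain r' y' where r': "strict_mono (r' :: nat \<Rightarrow> nat)" "weakly_converges ((x \<circ> q) \<circ> r') y'"
      by (rule bounded_weakly_convergent_subseq[of "x \<circ> q"])
    have "y' = y"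
      using uniq[of "q \<circ> r'" y'] r' q(1) by (simp add: strict_mono_o comp_assoc)
    then have "(\<lambda>k. inner (x (q (r' k))) v) \<longlonglongrightarrow> inner y v"
      using r'(2) by (auto simp: weakly_converges_def o_def)
    then have "\<forall>\<^sub>F k in sequentially. dist (inner (x (q (r' k))) v) (inner y v) < e"
      using e(1) by (rule tendstoD)
    then show False using q(2) by (auto simp: eventually_sequentially)
  qed
  then show ?thesis using cluster ry by blast
qed

section \<open>Strings of relaxed cutters\<close>

text \<open>By polarization each summand is half a difference of consecutive squared distances to
  \<open>u n\<close>, less half the squared increment. The differences telescope, and the other half
  square shifts \<open>c k\<close> to \<open>c k - 1/2\<close>.\<close>

lemma inner_telescoping_sum:
  fixes u :: "nat \<Rightarrow> 'a::real_inner"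
  shows "(\<Sum>k<n. inner (u n - u (Suc k) + c k *\<^sub>R (u (Suc k) - u k)) (u (Suc k) - u k))
       = (norm (u n - u 0))\<^sup>2 / 2 + (\<Sum>k<n. (c k - 1/2) * (norm (u (Suc k) - u k))\<^sup>2)"
proof -
  have "inner (u n - u (Suc k) + c k *\<^sub>R (u (Suc k) - u k)) (u (Suc k) - u k)
      = ((norm (u n - u k))\<^sup>2 - (norm (u n - u (Suc k)))\<^sup>2) / 2
        + (c k - 1/2) * (norm (u (Suc k) - u k))\<^sup>2" for k
    unfolding power2_norm_eq_inner
    by (simp add: inner_diff inner_add inner_commute field_simps)
  then have "(\<Sum>k<n. inner (u n - u (Suc k) + c k *\<^sub>R (u (Suc k) - u k)) (u (Suc k) - u k))
      = (\<Sum>k<n. (norm (u n - u k))\<^sup>2 - (norm (u n - u (Suc k)))\<^sup>2) / 2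
        + (\<Sum>k<n. (c k - 1/2) * (norm (u (Suc k) - u k))\<^sup>2)"
    by (simp only: sum.distrib sum_divide_distrib)
  then show ?thesis by (simp only: sum_lessThan_telescope'[where f = "\<lambda>k. (norm (u n - u k))\<^sup>2"]) simp
qed

text \<open>The bound is the right side of \<open>inner_telescoping_sum\<close>. In the induction
  step \<open>z - u 0\<close> splits into \<open>z - u n\<close>, covered by the hypothesis, and
  \<open>u n - u 0\<close>, whose product with the new increment is evaluated by
  polarization.\<close>

lemma inner_telescoping_lower_bound:
  fixes u :: "nat \<Rightarrow> 'a::real_inner"
  assumes "\<And>k. k < n \<Longrightarrow> c k * (norm (u (Suc k) - u k))\<^sup>2 \<le> inner (u (Suc k) - u k) (z - u k)"
  shows "(norm (u n - u 0))\<^sup>2 / 2 + (\<Sum>k<n. (c k - 1/2) * (norm (u (Suc k) - u k))\<^sup>2)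
       \<le> inner (u n - u 0) (z - u 0)"
  using assms
proof (induction n)
  case (Suc n)
  have "inner (u (Suc n) - u 0) (z - u 0) = inner (u n - u 0) (z - u 0)
      + inner (u (Suc n) - u n) (z - u n)
      + ((norm (u (Suc n) - u 0))\<^sup>2 - (norm (u n - u 0))\<^sup>2 - (norm (u (Suc n) - u n))\<^sup>2) / 2"
    unfolding power2_norm_eq_inner by (simp add: inner_diff inner_commute field_simps)
  moreover have "c n * (norm (u (Suc n) - u n))\<^sup>2 \<le> inner (u (Suc n) - u n) (z - u n)"
    using Suc.prems by simp
  moreover have "(norm (u n - u 0))\<^sup>2 / 2 + (\<Sum>k<n. (c k - 1/2) * (norm (u (Suc k) - u k))\<^sup>2)
       \<le> inner (u n - u 0) (z - u 0)"
    using Suc by simp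
  moreover have "(c n - 1/2) * (norm (u (Suc n) - u n))\<^sup>2
      = c n * (norm (u (Suc n) - u n))\<^sup>2 - (norm (u (Suc n) - u n))\<^sup>2 / 2"
    by (simp add: algebra_simps)
  ultimately show ?case unfolding sum.lessThan_Suc by argo
qed simp

text \<open>Jensen's inequality for the squared norm, obtained by averaging
  \<open>0 \<le> (norm (v t - q))\<^sup>2\<close> over \<open>t\<close>.\<close>

lemma norm_convex_combination_power2_le:
  fixes v :: "'b \<Rightarrow> 'a::real_inner"
  assumes "\<And>t. t \<in> A \<Longrightarrow> 0 \<le> w t" "sum w A = 1"
  shows "(norm (\<Sum>t\<in>A. w t *\<^sub>R v t))\<^sup>2 \<le> (\<Sum>t\<in>A. w t * (norm (v t))\<^sup>2)"
proof -
  define q where "q = (\<Sum>t\<in>A. w t *\<^sub>R v t)"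
  have "2 * inner (v t) q - (norm q)\<^sup>2 \<le> (norm (v t))\<^sup>2" for t
  proof -
    have "0 \<le> (norm (v t - q))\<^sup>2" by simp
    then show ?thesis
      unfolding power2_norm_eq_inner by (simp add: inner_diff inner_commute)
  qed
  then have "(\<Sum>t\<in>A. w t * (2 * inner (v t) q - (norm q)\<^sup>2)) \<le> (\<Sum>t\<in>A. w t * (norm (v t))\<^sup>2)"
    using assms(1) by (intro sum_mono mult_left_mono)
  moreover have "(\<Sum>t\<in>A. w t * (2 * inner (v t) q - (norm q)\<^sup>2))
      = 2 * (\<Sum>t\<in>A. inner (w t *\<^sub>R v t) q) - sum w A * (norm q)\<^sup>2"
    by (simp add: right_diff_distrib sum_subtractf sum_distrib_left sum_distrib_right mult.left_commute)
  moreover have "(\<Sum>t\<in>A. inner (w t *\<^sub>R v t) q) = (norm q)\<^sup>2"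
    unfolding inner_sum_left[symmetric] q_def[symmetric] power2_norm_eq_inner ..
  ultimately show ?thesis using assms(2) unfolding q_def by simp
qed

lemma norm_power2_tendsto_0_imp:
  fixes f :: "nat \<Rightarrow> 'b::real_normed_vector"
  assumes "g \<longlonglongrightarrow> 0" "0 < c" "\<And>k. c * (norm (f k))\<^sup>2 \<le> g k"
  shows "f \<longlonglongrightarrow> 0"
proof -
  have "(\<lambda>k. (norm (f k))\<^sup>2) \<longlonglongrightarrow> 0"
  proof (rule tendsto_sandwich[OF _ _ tendsto_const])
    show "\<forall>\<^sub>F k in sequentially. (norm (f k))\<^sup>2 \<le> g k / c"
      using assms(2,3) by (simp add: field_simps)
    show "(\<lambda>k. g k / c) \<longlonglongrightarrow> 0" using assms(1) by (rule tendsto_divide_zero)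
  qed simp
  then show ?thesis by (simp add: tendsto_norm_zero_iff)
qed

text \<open>The contribution of one string to the numerator of \<open>sigma_max\<close>, already in
  telescoped form, so that every term is nonnegative for relaxation parameters in (0,2).\<close>

definition string_gain ::
    "(nat \<Rightarrow> 'a::real_inner \<Rightarrow> 'a) \<Rightarrow> (nat \<Rightarrow> real) \<Rightarrow> nat list \<Rightarrow> 'a \<Rightarrow> real" where
  "string_gain T \<alpha> s x = (norm (string_op T s x - x))\<^sup>2 / 2 +
     (\<Sum>k<length s. (1 / \<alpha> (s ! k) - 1/2) *
        (norm (T (s ! k) (string_comp T s k x) - string_comp T s k x))\<^sup>2)"

lemma sigma_max_string_sum:
  "(\<Sum>j=1..length s. inner (string_op T s x - string_comp T s j x
        + (1 / \<alpha> (s ! (j - 1))) *\<^sub>R string_diff T s j x) (string_diff T s j x))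
   = string_gain T \<alpha> s x"
  using inner_telescoping_sum[of "\<lambda>j. string_comp T s j x" "length s" "\<lambda>k. 1 / \<alpha> (s ! k)"]
  by (simp add: sum.atLeast1_atMost_eq string_diff_def string_gain_def string_op_def)

text \<open>The cutter inequality at each intermediate point, divided by the relaxation parameter,
  is the hypothesis of \<open>inner_telescoping_lower_bound\<close> with
  \<open>c k = 1 / \<alpha> (s ! k)\<close>.\<close>

lemma string_gain_le_inner:
  assumes "\<And>i. i \<in> set s \<Longrightarrow> 0 < \<alpha> i" "\<And>i. i \<in> set s \<Longrightarrow> relaxed_cutter (\<alpha> i) (T i)"
    and "\<And>i. i \<in> set s \<Longrightarrow> z \<in> Fix (T i)"
  shows "string_gain T \<alpha> s x \<le> inner (string_op T s x - x) (z - x)"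
proof -
  let ?S = "\<lambda>j. string_comp T s j x"
  have "1 / \<alpha> (s ! k) * (norm (?S (Suc k) - ?S k))\<^sup>2 \<le> inner (?S (Suc k) - ?S k) (z - ?S k)"
    if "k < length s" for k
  proof -
    have "s ! k \<in> set s" using that by simp
    then have "(norm (?S (Suc k) - ?S k))\<^sup>2 \<le> \<alpha> (s ! k) * inner (?S (Suc k) - ?S k) (z - ?S k)"
      "0 < \<alpha> (s ! k)"
      using assms unfolding relaxed_cutter_def by auto
    then show ?thesis by (simp add: field_simps)
  qed
  then show ?thesis
    using inner_telescoping_lower_bound[of "length s" "\<lambda>k. 1 / \<alpha> (s ! k)" ?S z]
    by (simp add: string_gain_def string_op_def)
qed

lemma
  assumes "\<And>i. i \<in> set s \<Longrightarrow> \<alpha> i \<in> {0<..<2}"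
  shows string_gain_ge: "(norm (string_op T s x - x))\<^sup>2 / 2 \<le> string_gain T \<alpha> s x"
    and string_gain_ge_step: "k < length s \<Longrightarrow> (1 / \<alpha> (s ! k) - 1/2) *
      (norm (T (s ! k) (string_comp T s k x) - string_comp T s k x))\<^sup>2 \<le> string_gain T \<alpha> s x"
proof -
  let ?f = "\<lambda>k. (1 / \<alpha> (s ! k) - 1/2) *
      (norm (T (s ! k) (string_comp T s k x) - string_comp T s k x))\<^sup>2"
  have nonneg: "0 \<le> ?f k" if "k < length s" for k
  proof -
    have "0 < \<alpha> (s ! k)" "\<alpha> (s ! k) < 2" using assms[of "s ! k"] that by auto
    then show ?thesis by (intro mult_nonneg_nonneg) (auto simp: field_simps)
  qed
  then have "0 \<le> sum ?f {..<length s}" by (intro sum_nonneg) auto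
  then show "(norm (string_op T s x - x))\<^sup>2 / 2 \<le> string_gain T \<alpha> s x"
    by (simp add: string_gain_def)
  show "?f k \<le> string_gain T \<alpha> s x" if "k < length s"
  proof -
    have "?f k \<le> sum ?f {..<length s}"
      using that nonneg by (intro member_le_sum) auto
    moreover have "0 \<le> (norm (string_op T s x - x))\<^sup>2 / 2" by simp
    ultimately show ?thesis unfolding string_gain_def by linarith
  qed
qed

lemma string_comp_common_fixed_point:
  assumes "j \<le> length s" "\<And>i. i \<in> set s \<Longrightarrow> x \<in> Fix (T i)"
  shows "string_comp T s j x = x"
  using assms(1)
proof (induction j)
  case (Suc j)
  then have "s ! j \<in> set s" by simp
  then show ?case using Suc assms(2) by (simp add: Fix_def)
qed simp

section \<open>Weighted averages of string operators and the extrapolated step size\<close>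

locale string_averaging =
  fixes T :: "nat \<Rightarrow> 'a::{real_inner, complete_space} \<Rightarrow> 'a"
    and \<alpha> :: "nat \<Rightarrow> real"
    and m E :: nat
    and s :: "nat \<Rightarrow> nat list"
    and \<omega> :: "nat \<Rightarrow> real"
  assumes relaxation: "\<And>i. i \<in> {1..m} \<Longrightarrow> \<alpha> i \<in> {0<..<2}"
    and cutter: "\<And>i. i \<in> {1..m} \<Longrightarrow> relaxed_cutter (\<alpha> i) (T i)"
    and common: "(\<Inter>i\<in>{1..m}. Fix (T i)) \<noteq> {}"
    and strings: "(\<Union>t\<in>{1..E}. set (s t)) = {1..m}"
    and weight_pos: "\<And>t. t \<in> {1..E} \<Longrightarrow> \<omega> t > 0"
    and weight_sum: "(\<Sum>t=1..E. \<omega> t) = 1"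
begin

abbreviation avg :: "'a \<Rightarrow> 'a" where
  "avg \<equiv> string_average T E s \<omega>"

abbreviation step_size :: "'a \<Rightarrow> real" where
  "step_size \<equiv> sigma_max T \<alpha> E s \<omega>"

definition gain :: "'a \<Rightarrow> real" where
  "gain x = (\<Sum>t=1..E. \<omega> t * string_gain T \<alpha> (s t) x)"

lemma string_index: "t \<in> {1..E} \<Longrightarrow> i \<in> set (s t) \<Longrightarrow> i \<in> {1..m}"
  using strings by blast

lemma avg_diff: "avg x - x = (\<Sum>t=1..E. \<omega> t *\<^sub>R (string_op T (s t) x - x))"
  by (simp add: string_average_def scaleR_diff_right sum_subtractf weight_sum
      flip: scaleR_left.sum del: One_nat_def)

lemma gain_le_inner:
  assumes "z \<in> (\<Inter>i\<in>{1..m}. Fix (T i))"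
  shows "gain x \<le> inner (avg x - x) (z - x)"
proof -
  have "\<omega> t * string_gain T \<alpha> (s t) x \<le> inner (\<omega> t *\<^sub>R (string_op T (s t) x - x)) (z - x)"
    if t: "t \<in> {1..E}" for t
  proof -
    have "string_gain T \<alpha> (s t) x \<le> inner (string_op T (s t) x - x) (z - x)"
    proof (rule string_gain_le_inner)
      fix i assume "i \<in> set (s t)"
      then have i: "i \<in> {1..m}" by (rule string_index[OF t])
      show "0 < \<alpha> i" using relaxation[OF i] by simp
      show "relaxed_cutter (\<alpha> i) (T i)" by (rule cutter[OF i])
      show "z \<in> Fix (T i)" using assms i by blast
    qed
    then show ?thesis using weight_pos[OF t] by simp
  qed
  then show ?thesis
    unfolding gain_def avg_diff inner_sum_left by (intro sum_mono)
qed

lemma string_relaxation: "t \<in> {1..E} \<Longrightarrow> i \<in> set (s t) \<Longrightarrow> \<alpha> i \<in> {0<..<2}"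
  using string_index relaxation by blast

lemma string_gain_nonneg: "t \<in> {1..E} \<Longrightarrow> 0 \<le> string_gain T \<alpha> (s t) x"
  using string_gain_ge[of "s t" \<alpha> T x] string_relaxation order_trans[of 0 "(norm (string_op T (s t) x - x))\<^sup>2 / 2"] by simp

lemma gain_ge_string:
  assumes "t \<in> {1..E}"
  shows "\<omega> t * string_gain T \<alpha> (s t) x \<le> gain x"
  unfolding gain_def
proof (rule member_le_sum[OF assms])
  show "0 \<le> \<omega> t * string_gain T \<alpha> (s t) x" if "t \<in> {1..E} - {t'}" for t t'
    using that weight_pos[of t] string_gain_nonneg[of t x] by (intro mult_nonneg_nonneg) auto
qed simp

text \<open>Jensen's inequality bounds the displacement of the average by those of the strings, and
  each \<open>string_gain\<close> dominates half of its squared displacement.\<close>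

lemma gain_ge_avg: "(norm (avg x - x))\<^sup>2 / 2 \<le> gain x"
proof -
  have "(norm (avg x - x))\<^sup>2 \<le> (\<Sum>t=1..E. \<omega> t * (norm (string_op T (s t) x - x))\<^sup>2)"
    unfolding avg_diff
    by (intro norm_convex_combination_power2_le weight_sum less_imp_le weight_pos)
  also have "\<dots> \<le> (\<Sum>t=1..E. \<omega> t * (2 * string_gain T \<alpha> (s t) x))"
  proof (intro sum_mono mult_left_mono)
    fix t assume t: "t \<in> {1..E}"
    show "(norm (string_op T (s t) x - x))\<^sup>2 \<le> 2 * string_gain T \<alpha> (s t) x"
      using string_gain_ge[of "s t" \<alpha> T x] string_relaxation[OF t] by simp
    show "0 \<le> \<omega> t" using weight_pos[OF t] by simp
  qed
  also have "\<dots> = 2 * gain x"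
    by (simp add: gain_def sum_distrib_left mult.left_commute)
  finally show ?thesis by simp
qed

lemma string_gain_tendsto_0:
  assumes "(\<lambda>k. gain (x k)) \<longlonglongrightarrow> 0" "t \<in> {1..E}"
  shows "(\<lambda>k. string_gain T \<alpha> (s t) (x k)) \<longlonglongrightarrow> 0"
proof (rule tendsto_sandwich[OF _ _ tendsto_const])
  show "\<forall>\<^sub>F k in sequentially. 0 \<le> string_gain T \<alpha> (s t) (x k)"
    using string_gain_nonneg[OF assms(2)] by simp
  show "\<forall>\<^sub>F k in sequentially. string_gain T \<alpha> (s t) (x k) \<le> gain (x k) / \<omega> t"
    using gain_ge_string[OF assms(2)] weight_pos[OF assms(2)] by (simp add: field_simps)
  show "(\<lambda>k. gain (x k) / \<omega> t) \<longlonglongrightarrow> 0"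
    using assms(1) by (rule tendsto_divide_zero)
qed

lemma string_op_diff_tendsto_0:
  assumes "(\<lambda>k. gain (x k)) \<longlonglongrightarrow> 0" "t \<in> {1..E}"
  shows "(\<lambda>k. string_op T (s t) (x k) - x k) \<longlonglongrightarrow> 0"
  using string_gain_ge[of "s t" \<alpha> T] string_relaxation[OF assms(2)]
  by (intro norm_power2_tendsto_0_imp[OF string_gain_tendsto_0[OF assms], of "1/2"]) auto

lemma string_step_tendsto_0:
  assumes "(\<lambda>k. gain (x k)) \<longlonglongrightarrow> 0" "t \<in> {1..E}" "j < length (s t)"
  shows "(\<lambda>k. T (s t ! j) (string_comp T (s t) j (x k)) - string_comp T (s t) j (x k)) \<longlonglongrightarrow> 0"
proof (rule norm_power2_tendsto_0_imp[OF string_gain_tendsto_0[OF assms(1,2)]])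
  have "\<alpha> (s t ! j) \<in> {0<..<2}"
    using assms by (intro string_relaxation) auto
  then show "0 < 1 / \<alpha> (s t ! j) - 1/2" by (simp add: field_simps)
  show "(1 / \<alpha> (s t ! j) - 1/2) *
      (norm (T (s t ! j) (string_comp T (s t) j (x k)) - string_comp T (s t) j (x k)))\<^sup>2
      \<le> string_gain T \<alpha> (s t) (x k)" for k
    using assms by (intro string_gain_ge_step string_relaxation) auto
qed

lemma string_comp_diff_tendsto_0:
  assumes "(\<lambda>k. gain (x k)) \<longlonglongrightarrow> 0" "t \<in> {1..E}" "j \<le> length (s t)"
  shows "(\<lambda>k. string_comp T (s t) j (x k) - x k) \<longlonglongrightarrow> 0"
  using assms(3)
proof (induction j)
  case (Suc j)
  then have "j < length (s t)" "(\<lambda>k. string_comp T (s t) j (x k) - x k) \<longlonglongrightarrow> 0" by simp_all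
  from tendsto_add[OF string_step_tendsto_0[OF assms(1,2) this(1)] this(2)]
  show ?case by simp
qed simp

lemma Fix_avg: "Fix avg = (\<Inter>i\<in>{1..m}. Fix (T i))"
proof (intro equalityI subsetI)
  fix x assume x: "x \<in> Fix avg"
  obtain z where "z \<in> (\<Inter>i\<in>{1..m}. Fix (T i))" using common by blast
  from gain_le_inner[OF this, of x] have "gain x \<le> 0" using x by (simp add: Fix_def)
  moreover have "0 \<le> gain x" using gain_ge_avg[of x] order_trans[of 0 "(norm (avg x - x))\<^sup>2 / 2"] by simp
  \<comment> \<open>The gain vanishes at \<open>x\<close>, so the limit lemmas for increments,
    applied to the constant sequence \<open>x\<close>, show that no operator in any string moves the
    point.\<close>
  ultimately have gain: "(\<lambda>k::nat. gain x) \<longlonglongrightarrow> 0" by simp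
  show "x \<in> (\<Inter>i\<in>{1..m}. Fix (T i))"
  proof
    fix i assume "i \<in> {1..m}"
    then obtain t where t: "t \<in> {1..E}" "i \<in> set (s t)" using strings by blast
    then obtain j where j: "j < length (s t)" "s t ! j = i" by (auto simp: in_set_conv_nth)
    have "string_comp T (s t) j x = x"
      using LIMSEQ_unique[OF tendsto_const string_comp_diff_tendsto_0[OF gain t(1)], of j] j by simp
    moreover have "T i (string_comp T (s t) j x) = string_comp T (s t) j x"
      using LIMSEQ_unique[OF tendsto_const string_step_tendsto_0[OF gain t(1) j(1)]] j by simp
    ultimately show "x \<in> Fix (T i)" by (simp add: Fix_def)
  qed
next
  fix x assume x: "x \<in> (\<Inter>i\<in>{1..m}. Fix (T i))"
  have "string_op T (s t) x = x" if "t \<in> {1..E}" for t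
    unfolding string_op_def
    using x string_index[OF that] by (intro string_comp_common_fixed_point) auto
  then have "avg x - x = 0" unfolding avg_diff by simp
  then show "x \<in> Fix avg" by (simp add: Fix_def)
qed

text \<open>On \<open>Fix avg\<close> both sides vanish, so the identity holds there whatever value
  the step size is given.\<close>

lemma gain_eq: "gain x = step_size x * (norm (avg x - x))\<^sup>2"
proof (cases "x \<in> Fix avg")
  case True
  from gain_le_inner[of x x] have "gain x \<le> 0" using True by (simp add: Fix_avg)
  then show ?thesis using gain_ge_avg[of x] True by (simp add: Fix_def)
next
  case False
  then have "avg x - x \<noteq> 0" by (simp add: Fix_def)
  then show ?thesis
    unfolding sigma_max_def sigma_max_string_sum gain_def using False by simp
qed

lemma step_size_ge: "1/2 \<le> step_size x"
proof (cases "x \<in> Fix avg")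
  case False
  then have "0 < (norm (avg x - x))\<^sup>2" by (simp add: Fix_def)
  moreover have "1/2 * (norm (avg x - x))\<^sup>2 \<le> step_size x * (norm (avg x - x))\<^sup>2"
    using gain_ge_avg[of x] by (simp add: gain_eq)
  ultimately show ?thesis by (simp only: mult_le_cancel_right_pos)
qed (simp add: sigma_max_def)

text \<open>Expand the square. By \<open>gain_le_inner\<close> and \<open>gain_eq\<close> the cross
  term is at least \<open>2 * lam * c\<^sup>2 * (norm d)\<^sup>2\<close>, against a quadratic term
  of \<open>lam\<^sup>2 * c\<^sup>2 * (norm d)\<^sup>2\<close>.\<close>

lemma extrapolated_step_Fejer:
  assumes "z \<in> Fix avg" "0 \<le> lam"
  shows "(norm (x + (lam * step_size x) *\<^sub>R (avg x - x) - z))\<^sup>2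
       \<le> (norm (x - z))\<^sup>2 - lam * (2 - lam) * (step_size x * norm (avg x - x))\<^sup>2"
proof -
  define d where "d = avg x - x"
  define c where "c = step_size x"
  have "c * (norm d)\<^sup>2 \<le> inner d (z - x)"
    using gain_le_inner[of z x] assms(1) unfolding Fix_avg gain_eq c_def d_def by simp
  then have "lam * c * (c * (norm d)\<^sup>2) \<le> lam * c * inner d (z - x)"
    using assms(2) step_size_ge[of x] by (intro mult_left_mono) (auto simp: c_def)
  moreover have "(norm (x + (lam * c) *\<^sub>R d - z))\<^sup>2
      = (norm (x - z))\<^sup>2 - 2 * (lam * c * inner d (z - x)) + (lam * c)\<^sup>2 * (norm d)\<^sup>2"
    unfolding power2_norm_eq_inner
    by (simp add: inner_diff inner_add inner_commute power2_eq_square algebra_simps)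
  ultimately show ?thesis
    unfolding c_def[symmetric] d_def[symmetric]
    by (simp add: power_mult_distrib power2_eq_square algebra_simps)
qed

lemma demiclosed_imp_Fix_avg:
  assumes gain: "(\<lambda>k. gain (x k)) \<longlonglongrightarrow> 0" and y: "weakly_converges x y"
    and demi: "demiclosed_at_0 (\<lambda>y. avg y - y)
       \<or> (\<forall>t\<in>{1..E}. demiclosed_at_0 (\<lambda>y. string_op T (s t) y - y))
       \<or> (\<forall>i\<in>{1..m}. demiclosed_at_0 (\<lambda>y. T i y - y))"
  shows "y \<in> Fix avg"
  using demi
proof (elim disjE)
  assume "demiclosed_at_0 (\<lambda>y. avg y - y)"
  moreover have "(\<lambda>k. avg (x k) - x k) \<longlonglongrightarrow> 0"
    using gain_ge_avg by (intro norm_power2_tendsto_0_imp[OF gain, of "1/2"]) auto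
  ultimately have "avg y - y = 0" using y unfolding demiclosed_at_0_def by blast
  then show ?thesis by (simp add: Fix_def)
next
  assume "\<forall>t\<in>{1..E}. demiclosed_at_0 (\<lambda>y. string_op T (s t) y - y)"
  then have "string_op T (s t) y - y = 0" if "t \<in> {1..E}" for t
    using that y string_op_diff_tendsto_0[OF gain] unfolding demiclosed_at_0_def by blast
  then have "avg y - y = 0" unfolding avg_diff by simp
  then show ?thesis by (simp add: Fix_def)
next
  assume demi: "\<forall>i\<in>{1..m}. demiclosed_at_0 (\<lambda>y. T i y - y)"
  have "y \<in> Fix (T i)" if i: "i \<in> {1..m}" for i
  proof -
    obtain t where t: "t \<in> {1..E}" "i \<in> set (s t)" using strings i by blast
    then obtain j where j: "j < length (s t)" "s t ! j = i" by (auto simp: in_set_conv_nth)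
    \<comment> \<open>Demi-closedness of \<open>T i\<close> is used along the points on which
      \<open>T i\<close> acts within the string; they have the same weak limit as
      \<open>x\<close>.\<close>
    let ?w = "\<lambda>k. string_comp T (s t) j (x k)"
    have "weakly_converges (\<lambda>k. x k + (?w k - x k)) y"
      using j by (intro weakly_converges_add_null[OF y] string_comp_diff_tendsto_0[OF gain t(1)]) simp
    then have "weakly_converges ?w y" by simp
    moreover have "(\<lambda>k. T i (?w k) - ?w k) \<longlonglongrightarrow> 0"
      using string_step_tendsto_0[OF gain t(1) j(1)] j(2) by simp
    ultimately have "T i y - y = 0"
      using demi i unfolding demiclosed_at_0_def by blast
    then show ?thesis by (simp add: Fix_def)
  qed
  then show ?thesis unfolding Fix_avg by blast
qed

end

section \<open>Fejer monotonicity and weak convergence of the projected iteration\<close>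

theorem theorem3p11:
  fixes T :: "nat \<Rightarrow> 'a::{real_inner, complete_space} \<Rightarrow> 'a"
    and \<alpha> :: "nat \<Rightarrow> real"
    and m E :: nat
    and s :: "nat \<Rightarrow> nat list"
    and \<omega> :: "nat \<Rightarrow> real"
    and \<epsilon> lam :: real
    and \<Omega> :: "'a set"
    and x :: "nat \<Rightarrow> 'a"
  assumes "\<And>i. i \<in> {1..m} \<Longrightarrow> \<alpha> i \<in> {0<..<2}"
    and "\<And>i. i \<in> {1..m} \<Longrightarrow> relaxed_cutter (\<alpha> i) (T i)"
    and "(\<Inter>i\<in>{1..m}. Fix (T i)) \<noteq> {}"
    and "\<And>t. t \<in> {1..E} \<Longrightarrow> distinct (s t)"
    and "(\<Union>t\<in>{1..E}. set (s t)) = {1..m}"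
    and "\<And>t. t \<in> {1..E} \<Longrightarrow> \<omega> t > 0"
    and "(\<Sum>t=1..E. \<omega> t) = 1"
    and "\<epsilon> \<in> {0<..<1}"
    and "lam \<in> {\<epsilon>..2 - \<epsilon>}"
    and "closed \<Omega>"
    and "convex \<Omega>"
    and "\<Omega> \<inter> Fix (string_average T E s \<omega>) \<noteq> {}"
    and "\<And>k. x (Suc k) = proj \<Omega> (x k + (lam * sigma_max T \<alpha> E s \<omega> (x k)) *\<^sub>R
                                       (string_average T E s \<omega> (x k) - x k))"
    and "demiclosed_at_0 (\<lambda>y. string_average T E s \<omega> y - y)
       \<or> (\<forall>t\<in>{1..E}. demiclosed_at_0 (\<lambda>y. string_op T (s t) y - y))
       \<or> (\<forall>i\<in>{1..m}. demiclosed_at_0 (\<lambda>y. T i y - y))"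
  shows "\<exists>y \<in> Fix (string_average T E s \<omega>) \<inter> \<Omega>. weakly_converges x y"
proof -
  interpret string_averaging T \<alpha> m E s \<omega>
    by unfold_locales (use assms in blast)+
  have lam: "0 < lam" "lam < 2" using assms(8,9) by auto
  have in_\<Omega>: "x (Suc k) \<in> \<Omega>" for k
    unfolding assms(13) using assms(10-12) by (intro proj_in) auto
  have Fejer: "(norm (x (Suc k) - z))\<^sup>2
      \<le> (norm (x k - z))\<^sup>2 - lam * (2 - lam) * (step_size (x k) * norm (avg (x k) - x k))\<^sup>2"
    if z: "z \<in> Fix avg \<inter> \<Omega>" for z k
  proof -
    have "(norm (x (Suc k) - z))\<^sup>2
        \<le> (norm (x k + (lam * step_size (x k)) *\<^sub>R (avg (x k) - x k) - z))\<^sup>2"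
      unfolding assms(13) using assms(10,11) z by (intro power_mono proj_dist_le) auto
    also have "\<dots> \<le> (norm (x k - z))\<^sup>2
        - lam * (2 - lam) * (step_size (x k) * norm (avg (x k) - x k))\<^sup>2"
      using z lam by (intro extrapolated_step_Fejer) auto
    finally show ?thesis .
  qed
  have conv: "convergent (\<lambda>k. norm (x k - z))" if z: "z \<in> Fix avg \<inter> \<Omega>" for z
  proof -
    have "norm (x (Suc k) - z) \<le> norm (x k - z)" for k
    proof (rule power2_le_imp_le)
      have "0 \<le> lam * (2 - lam) * (step_size (x k) * norm (avg (x k) - x k))\<^sup>2"
        using lam by simp
      then show "(norm (x (Suc k) - z))\<^sup>2 \<le> (norm (x k - z))\<^sup>2"
        using Fejer[OF z, of k] by linarith
    qed simp
    then have "decseq (\<lambda>k. norm (x k - z))" by (simp add: decseq_SucI)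
    then show ?thesis
      using decseq_convergent[of _ 0] by (metis convergentI norm_ge_zero)
  qed
  obtain z where z: "z \<in> Fix avg \<inter> \<Omega>" using assms(12) by blast
  obtain l where l: "(\<lambda>k. norm (x k - z)) \<longlonglongrightarrow> l"
    using conv[OF z] unfolding convergent_def by blast
  have diff: "(\<lambda>k. (norm (x k - z))\<^sup>2 - (norm (x (Suc k) - z))\<^sup>2) \<longlonglongrightarrow> 0"
    using tendsto_diff[OF tendsto_power[OF l] tendsto_power[OF LIMSEQ_Suc[OF l]], of 2 2] by simp
  have step: "(\<lambda>k. step_size (x k) * norm (avg (x k) - x k)) \<longlonglongrightarrow> 0"
  proof (rule norm_power2_tendsto_0_imp[OF diff])
    show "0 < lam * (2 - lam)" using lam by simp
    show "lam * (2 - lam) * (norm (step_size (x k) * norm (avg (x k) - x k)))\<^sup>2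
        \<le> (norm (x k - z))\<^sup>2 - (norm (x (Suc k) - z))\<^sup>2" for k
      using Fejer[OF z, of k] by simp
  qed
  have gain: "(\<lambda>k. gain (x k)) \<longlonglongrightarrow> 0"
  proof (rule tendsto_sandwich[OF _ _ tendsto_const])
    \<comment> \<open>Since \<open>step_size y\<close> is at least \<open>1/2\<close>, multiplying
      the gain by \<open>2 * step_size y\<close> does not decrease it; this yields the square of the
      quantity known to tend to 0.\<close>
    have "gain y \<le> 2 * (step_size y * norm (avg y - y))\<^sup>2" for y
    proof -
      have "step_size y * (norm (avg y - y))\<^sup>2 * 1
          \<le> step_size y * (norm (avg y - y))\<^sup>2 * (2 * step_size y)"
        using step_size_ge[of y] by (intro mult_left_mono) auto
      then show ?thesis by (simp add: gain_eq power2_eq_square algebra_simps)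
    qed
    then show "\<forall>\<^sub>F k in sequentially.
        gain (x k) \<le> 2 * (step_size (x k) * norm (avg (x k) - x k))\<^sup>2"
      by simp
    show "(\<lambda>k. 2 * (step_size (x k) * norm (avg (x k) - x k))\<^sup>2) \<longlonglongrightarrow> 0"
      using tendsto_mult[OF tendsto_const[of 2] tendsto_power[OF step, of 2]] by simp
    have "0 \<le> gain y" for y
      unfolding gain_eq using step_size_ge[of y] by (intro mult_nonneg_nonneg) auto
    then show "\<forall>\<^sub>F k in sequentially. 0 \<le> gain (x k)" by simp
  qed
  show ?thesis
  proof (rule Opial_weak_convergence)
    show "Fix avg \<inter> \<Omega> \<noteq> {}" using z by blast
    show "convergent (\<lambda>k. norm (x k - z))" if "z \<in> Fix avg \<inter> \<Omega>" for z
      by (rule conv[OF that])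
    fix r :: "nat \<Rightarrow> nat" and y
    assume r: "strict_mono r" and y: "weakly_converges (x \<circ> r) y"
    have "(\<lambda>k. gain ((x \<circ> r) k)) \<longlonglongrightarrow> 0"
      using LIMSEQ_subseq_LIMSEQ[OF gain r] by (simp add: o_def)
    then have "y \<in> Fix avg" by (rule demiclosed_imp_Fix_avg[OF _ y assms(14)])
    moreover have "y \<in> \<Omega>"
    proof (rule weakly_converges_in_closed_convex[OF assms(10,11) y])
      \<comment> \<open>The starting point may lie outside \<open>\<Omega>\<close>; for
        \<open>k \<ge> 1\<close> the index \<open>r k\<close> is positive, so the iterate is a
        projection.\<close>
      have "(x \<circ> r) k \<in> \<Omega>" if "k \<ge> 1" for k
        using in_\<Omega>[of "r k - 1"] seq_suble[OF r, of k] that by simp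
      then show "\<forall>\<^sub>F k in sequentially. (x \<circ> r) k \<in> \<Omega>"
        unfolding eventually_sequentially by blast
    qed
    ultimately show "y \<in> Fix avg \<inter> \<Omega>" by blast
  qed
qed

end
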